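(* Let $k\geq 2$ and $n>6k^{2}$ be integers, and let $G$ be a graph of order $n$. If $q(G)\geq n+2k-2$, then $G$ contains a cycle of length $2k+1$ and a cycle of length $2k+2$ (as subgraphs).
   Context: All graphs are finite and simple. For a graph $G$, the signless Laplacian is $Q(G)=D(G)+A(G)$, where $D(G)$ is the diagonal matrix of vertex degrees and $A(G)$ is the adjacency matrix; $q(G)$ denotes the largest eigenvalue of $Q(G)$. *)

theory Defs
  imports "HOL-Analysis.Analysis"
begin

definition simple_graph :: "'a set \<Rightarrow> ('a \<Rightarrow> 'a \<Rightarrow> bool) \<Rightarrow> bool" where
  "simple_graph V E \<longleftrightarrow> finite V \<and>
     (\<forall>u v. E u v \<longrightarrow> u \<in> V \<and> v \<in> V \<and> u \<noteq> v) \<and>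
     (\<forall>u v. E u v \<longrightarrow> E v u)"

definition degree :: "'a set \<Rightarrow> ('a \<Rightarrow> 'a \<Rightarrow> bool) \<Rightarrow> 'a \<Rightarrow> nat" where
  "degree V E v = card {u \<in> V. E v u}"

definition signless_laplacian :: "'a set \<Rightarrow> ('a \<Rightarrow> 'a \<Rightarrow> bool) \<Rightarrow> 'a \<Rightarrow> 'a \<Rightarrow> real" where
  "signless_laplacian V E u v =
     (if u = v then real (degree V E u) else 0) + (if E u v then 1 else 0)"

text \<open>Eigenvalues of Q(G) (Q is real symmetric, so all eigenvalues are real
  and admit real eigenvectors).\<close>
definition sl_eigenvalue :: "'a set \<Rightarrow> ('a \<Rightarrow> 'a \<Rightarrow> bool) \<Rightarrow> real \<Rightarrow> bool" where
  "sl_eigenvalue V E \<mu> \<longleftrightarrow>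
     (\<exists>x :: 'a \<Rightarrow> real. (\<exists>v\<in>V. x v \<noteq> 0) \<and>
        (\<forall>u\<in>V. (\<Sum>v\<in>V. signless_laplacian V E u v * x v) = \<mu> * x u))"

definition q_index :: "'a set \<Rightarrow> ('a \<Rightarrow> 'a \<Rightarrow> bool) \<Rightarrow> real" where
  "q_index V E = Max {\<mu>. sl_eigenvalue V E \<mu>}"

definition has_cycle :: "'a set \<Rightarrow> ('a \<Rightarrow> 'a \<Rightarrow> bool) \<Rightarrow> nat \<Rightarrow> bool" where
  "has_cycle V E L \<longleftrightarrow>
     (\<exists>xs. length xs = L \<and> distinct xs \<and> set xs \<subseteq> V \<and>
        (\<forall>i<L. E (xs ! i) (xs ! ((i + 1) mod L))))"

end

theory Submission
  imports Defs "Jordan_Normal_Form.Spectral_Radius"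
begin

text \<open>
  Let \<open>x\<close> be an eigenvector of \<open>q = q(G)\<close>, scaled so that \<open>\<bar>x v\<bar> \<le> d(v)\<close> for all vertices, and call
  a vertex \<open>u\<close> with \<open>\<bar>x u\<bar> = d(u) > 0\<close> tight. Write \<open>A\<close> for the neighbourhood of \<open>u\<close>, \<open>B\<close> for the set of
  the remaining vertices other than \<open>u\<close>, and \<open>a\<close>, \<open>b\<close> for their sizes. The eigenvalue equation at \<open>u\<close>
  gives \<open>(\<Sum>v\<in>A. \<bar>x v\<bar>) \<ge> (b + 2k - 1) a\<close>, hence \<open>2 e(A) + e(A,B) \<ge> (b + 2k - 2) a\<close>. A path on \<open>L\<close>
  vertices inside \<open>A\<close> closes up to a cycle of length \<open>L + 1\<close> through \<open>u\<close>, so \<open>A\<close> may be assumed to have no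
  such path, and the Erdos--Gallai theorem bounds \<open>e(A)\<close>.

  If \<open>b \<ge> 2k\<close>, almost all (for the odd cycle: all) pairs between \<open>A\<close> and \<open>B\<close> are edges, and the cycle is
  found by alternating between \<open>A\<close> and \<open>B \<union> {u}\<close>. If \<open>b < 2k\<close>, look at the components of \<open>G[A]\<close>. On a
  component with at most \<open>2k\<close> vertices the eigenvalue equation forces \<open>\<bar>x v\<bar> < b + 2k - 1\<close>; a larger
  component \<open>C\<close> without a path on \<open>2k + 1\<close> vertices has at most \<open>(k - 1) |C|\<close> edges, so the degrees
  on \<open>C\<close> average at most \<open>b + 2k - 1\<close>. Therefore equality holds everywhere, and every vertex
  of \<open>A\<close> is tight as well. If none of them falls under the case \<open>b \<ge> 2k\<close>, then \<open>G[A]\<close> is far too dense to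
  have no path on \<open>2k + 1\<close> vertices.
\<close>

hide_const (open) Polynomial.degree

section \<open>Longest paths in connected graphs\<close>

definition path_in :: "'a set \<Rightarrow> ('a \<Rightarrow> 'a \<Rightarrow> bool) \<Rightarrow> 'a list \<Rightarrow> bool" where
  "path_in A E xs \<longleftrightarrow> distinct xs \<and> set xs \<subseteq> A \<and> successively E xs"

text \<open>Closed sets are the unions of components of the graph induced on \<open>A\<close>. They
  express connectivity without walks; the empty set counts as connected.\<close>

definition closed_in :: "'a set \<Rightarrow> ('a \<Rightarrow> 'a \<Rightarrow> bool) \<Rightarrow> 'a set \<Rightarrow> bool" where
  "closed_in A E S \<longleftrightarrow> S \<subseteq> A \<and> (\<forall>v\<in>S. \<forall>w\<in>A. E v w \<longrightarrow> w \<in> S)"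

definition connected_in :: "'a set \<Rightarrow> ('a \<Rightarrow> 'a \<Rightarrow> bool) \<Rightarrow> bool" where
  "connected_in A E \<longleftrightarrow> (\<forall>S. closed_in A E S \<longrightarrow> S \<noteq> {} \<longrightarrow> S = A)"

lemma successively_nth:
  "successively P xs \<Longrightarrow> Suc i < length xs \<Longrightarrow> P (xs ! i) (xs ! Suc i)"
proof (induction P xs arbitrary: i rule: successively.induct)
  case (3 P x y xs)
  then show ?case by (cases i) auto
qed auto

lemma has_cycleI:
  assumes "path_in V E xs" "xs \<noteq> []" "E (last xs) (hd xs)"
  shows "has_cycle V E (length xs)"
  unfolding has_cycle_def
proof (intro exI conjI allI impI)
  fix i assume i: "i < length xs"
  show "E (xs ! i) (xs ! ((i + 1) mod length xs))"
  proof (cases "Suc i = length xs")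
    case True
    then have "last xs = xs ! i" "hd xs = xs ! 0"
      using assms(2) by (simp_all add: last_conv_nth hd_conv_nth flip: True)
    then show ?thesis using True assms(3) by simp
  next
    case False
    then show ?thesis using i assms(1) by (simp add: path_in_def successively_nth)
  qed
qed (use assms in \<open>auto simp: path_in_def\<close>)

lemma path_in_take: "path_in A E xs \<Longrightarrow> path_in A E (take m xs)"
  by (metis append_take_drop_id path_in_def distinct_take successively_append_iff set_take_subset
      subset_trans)

lemma path_in_mono: "path_in A E xs \<Longrightarrow> A \<subseteq> B \<Longrightarrow> path_in B E xs"
  by (auto simp: path_in_def)

lemma path_in_length_le: "path_in A E xs \<Longrightarrow> finite A \<Longrightarrow> length xs \<le> card A"
  by (metis card_mono distinct_card path_in_def)

lemma closed_in_path:
  assumes "closed_in A E S" "path_in A E (x # xs)" "x \<in> S"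
  shows "set (x # xs) \<subseteq> S"
  using assms
proof (induction xs arbitrary: x)
  case (Cons y ys)
  then have "y \<in> S" by (auto simp: path_in_def closed_in_def)
  then show ?case using Cons.IH[of y] Cons.prems by (auto simp: path_in_def)
qed auto

lemma ex_longest_path:
  assumes "finite A"
  obtains xs where "path_in A E xs" "\<And>ys. path_in A E ys \<Longrightarrow> length ys \<le> length xs"
proof -
  have "path_in A E []" by (simp add: path_in_def)
  moreover have "\<forall>ys. path_in A E ys \<longrightarrow> length ys < Suc (card A)"
    using path_in_length_le[OF _ assms] by (simp add: less_Suc_eq_le)
  ultimately have "\<exists>xs. path_in A E xs \<and> (\<forall>ys. path_in A E ys \<longrightarrow> length ys \<le> length xs)"
    by (rule ex_has_greatest_nat)
  then show thesis using that by blast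
qed

section \<open>Components and degree sums\<close>

locale undirected =
  fixes E :: "'a \<Rightarrow> 'a \<Rightarrow> bool"
  assumes edge_sym: "E u v \<Longrightarrow> E v u"
    and edge_irrefl: "\<not> E v v"
begin

lemma path_in_rev: "path_in A E (rev xs) \<longleftrightarrow> path_in A E xs"
proof -
  have "successively (\<lambda>x y. E y x) xs = successively E xs"
    by (rule successively_cong) (use edge_sym in blast)+
  then show ?thesis unfolding path_in_def successively_rev by simp
qed

text \<open>A proper nonempty closed set and its complement are both closed, so \<open>A\<close> can
  be split until each piece is connected. Closedness is transitive, hence every final piece is a
  component of the original \<open>A\<close>. This reduces additive bounds to components.\<close>

lemma component_induct [consumes 1, case_names empty union component]:
  assumes "finite A"
    and empty: "P {}"
    and union: "\<And>S T. finite S \<Longrightarrow> finite T \<Longrightarrow> S \<inter> T = {} \<Longrightarrow> P S \<Longrightarrow> P T \<Longrightarrow> P (S \<union> T)"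
    and component: "\<And>C. C \<noteq> {} \<Longrightarrow> closed_in A E C \<Longrightarrow> connected_in C E \<Longrightarrow> P C"
  shows "P A"
  using assms(1) component
proof (induction A rule: finite_psubset_induct)
  case (psubset A)
  show ?case
  proof (cases "A = {} \<or> connected_in A E")
    case True
    then show ?thesis using empty psubset.prems[of A] by (auto simp: closed_in_def)
  next
    case False
    then obtain S where S: "closed_in A E S" "S \<noteq> {}" "S \<noteq> A"
      by (auto simp: connected_in_def)
    then have T: "closed_in A E (A - S)" using edge_sym by (auto simp: closed_in_def)
    have closed_trans: "closed_in A E C" if "closed_in A E S'" "closed_in S' E C" for S' C
      using that by (auto simp: closed_in_def)
    have SA: "S \<subset> A" "A - S \<subset> A" using S by (auto simp: closed_in_def)
    have "P S" by (rule psubset.IH[OF SA(1)]) (use psubset.prems closed_trans[OF S(1)] in auto)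
    moreover have "P (A - S)"
      by (rule psubset.IH[OF SA(2)]) (use psubset.prems closed_trans[OF T] in auto)
    ultimately have "P (S \<union> (A - S))"
      using SA psubset.hyps by (intro union) (auto intro: finite_subset)
    then show ?thesis using SA by (simp add: Un_absorb1 less_imp_le)
  qed
qed

text \<open>An edge at \<open>v\<close> counts once at \<open>v\<close> and once at its other end.
  Edge numbers appear throughout as degree sums, that is, doubled.\<close>

lemma degree_remove:
  assumes "finite A" "v \<in> A"
  shows "(\<Sum>w\<in>A. degree A E w) = (\<Sum>w\<in>A - {v}. degree (A - {v}) E w) + 2 * degree A E v"
proof -
  have *: "degree A E w = degree (A - {v}) E w + (if E v w then 1 else 0)" for w
  proof -
    have "{u \<in> A. E w u} = {u \<in> A - {v}. E w u} \<union> (if E v w then {v} else {})"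
      using assms(2) edge_sym by auto
    then show ?thesis using assms(1) by (simp add: degree_def card_Un_disjoint)
  qed
  have "(\<Sum>w\<in>A. degree A E w) = degree A E v + (\<Sum>w\<in>A - {v}. degree A E w)"
    using assms by (simp add: sum.remove)
  also have "(\<Sum>w\<in>A - {v}. degree A E w) = (\<Sum>w\<in>A - {v}. degree (A - {v}) E w)
      + (\<Sum>w\<in>A - {v}. if E v w then 1 else 0)"
    unfolding * sum.distrib by simp
  also have "(\<Sum>w\<in>A - {v}. if E v w then 1 else 0) = degree A E v"
  proof -
    have "{w \<in> A - {v}. E v w} = {w \<in> A. E v w}" using edge_irrefl by auto
    then show ?thesis using assms(1) by (simp add: degree_def sum.If_cases Int_def)
  qed
  finally show ?thesis by simp
qed

lemma degree_less_card: "finite A \<Longrightarrow> v \<in> A \<Longrightarrow> degree A E v < card A"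
  unfolding degree_def using edge_irrefl by (intro psubset_card_mono) auto

lemma degree_sum_le_complete:
  assumes "finite A"
  shows "(\<Sum>v\<in>A. degree A E v) \<le> card A * (card A - 1)"
  using sum_bounded_above[of A "degree A E" "card A - 1"] degree_less_card[OF assms] by fastforce

end

text \<open>In a connected graph a longest path that misses a vertex cannot be closed up to a cycle,
  since otherwise it could be rerouted along an edge leaving the cycle.\<close>

locale longest_path = undirected +
  fixes A and p
  assumes finA: "finite A"
    and conn: "connected_in A E"
    and path: "path_in A E p"
    and longest: "\<And>q. path_in A E q \<Longrightarrow> length q \<le> length p"
    and short: "length p < card A"
begin

lemma card_set: "card (set p) = length p"
  using path distinct_card by (auto simp: path_in_def)

lemma ex_missed: obtains w where "w \<in> A" "w \<notin> set p"
proof -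
  have "\<not> A \<subseteq> set p" using card_mono[of "set p" A] short card_set by auto
  then show thesis using that by blast
qed

lemma p_nonempty: "p \<noteq> []"
proof -
  obtain w where "w \<in> A" using ex_missed .
  then show ?thesis using longest[of "[w]"] by (auto simp: path_in_def)
qed

lemma hd_neighbour: "w \<in> A \<Longrightarrow> E (hd p) w \<Longrightarrow> w \<in> set p"
proof (rule ccontr)
  assume w: "w \<in> A" "E (hd p) w" "w \<notin> set p"
  then have "path_in A E (w # p)"
    using path edge_sym by (cases p) (auto simp: path_in_def)
  then show False using longest by fastforce
qed

lemma no_spanning_cycle:
  assumes q: "path_in A E q" "set q = set p"
  shows "\<not> E (last q) (hd q)"
proof
  assume cyc: "E (last q) (hd q)"
  have "\<not> closed_in A E (set p)"
    using conn p_nonempty ex_missed path unfolding connected_in_def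
    by (metis set_empty)
  then obtain v w where vw: "v \<in> set q" "w \<in> A" "E v w" "w \<notin> set q"
    using path q by (auto simp: closed_in_def path_in_def)
  obtain xs ys where qs: "q = xs @ v # ys" using split_list[OF vw(1)] by blast
  have "successively E xs" "successively E (v # ys)"
    using q(1) unfolding qs path_in_def successively_append_iff by blast+
  then have "successively E ((v # ys) @ xs)"
    using cyc unfolding successively_append_iff by (cases xs) (auto simp: qs)
  \<comment> \<open>The cycle is cut open just before \<open>v\<close>, and the outside vertex
    \<open>w\<close> is put in front.\<close>
  then have "path_in A E (w # v # ys @ xs)"
    using q(1) vw edge_sym[OF vw(3)] by (auto simp: qs path_in_def)
  then have "length (w # v # ys @ xs) \<le> length p" by (rule longest)
  moreover have "length q = length p"
    using card_set q distinct_card[of q] by (simp add: path_in_def)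
  ultimately show False by (simp add: qs)
qed

text \<open>Otherwise run from \<open>p ! 0\<close> to \<open>p ! i\<close>, jump to the last
  vertex, return backwards to \<open>p ! Suc i\<close> and close up at \<open>p ! 0\<close>: a cycle
  on all vertices of \<open>p\<close>.\<close>

lemma no_crossing:
  assumes "Suc i < length p" "E (p ! 0) (p ! Suc i)"
  shows "\<not> E (last p) (p ! i)"
proof
  assume "E (last p) (p ! i)"
  let ?xs = "take (Suc i) p" and ?ys = "drop (Suc i) p"
  have ne: "?xs \<noteq> []" "?ys \<noteq> []" using assms(1) by auto
  have last: "last ?xs = p ! i" using assms(1) p_nonempty by (simp add: last_conv_nth min_def)
  have hd: "hd ?ys = p ! Suc i" using assms(1) by (simp add: hd_drop_conv_nth)
  have "path_in A E (?xs @ ?ys)" using path by simp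
  then have p': "distinct (?xs @ ?ys)" "set (?xs @ ?ys) \<subseteq> A" "successively E ?xs" "path_in A E ?ys"
    unfolding path_in_def successively_append_iff by (auto simp del: append_take_drop_id)
  have "path_in A E (rev ?ys)" using p'(4) by (simp add: path_in_rev)
  then have "path_in A E (?xs @ rev ?ys)"
    using p' \<open>E (last p) (p ! i)\<close> ne last edge_sym
    unfolding path_in_def successively_append_iff
    by (auto simp: hd_rev simp del: append_take_drop_id)
  moreover have "set (?xs @ rev ?ys) = set p"
    by (metis append_take_drop_id set_append set_rev)
  moreover have "last (?xs @ rev ?ys) = p ! Suc i" using ne hd by (simp add: last_rev)
  moreover have "hd (?xs @ rev ?ys) = p ! 0" using ne p_nonempty by (simp add: hd_conv_nth nth_append)
  ultimately show False using no_spanning_cycle assms(2) edge_sym by metis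
qed

text \<open>By maximality all neighbours of both ends lie on \<open>p\<close>. Shift the positions
  of the neighbours of the first vertex down by one: by \<open>no_crossing\<close> they avoid the
  positions of the neighbours of the last vertex, and both sets lie in
  \<open>{..<length p - 1}\<close>.\<close>

lemma end_degrees: "degree A E (hd p) + degree A E (last p) < length p"
proof -
  let ?t = "length p - 1"
  define I where "I = {i. i < ?t \<and> E (p ! 0) (p ! Suc i)}"
  define J where "J = {i. i < ?t \<and> E (last p) (p ! i)}"
  have hd: "hd p = p ! 0" and last: "last p = p ! ?t"
    using p_nonempty by (simp_all add: hd_conv_nth last_conv_nth)
  interpret rev: longest_path E A "rev p"
    using conn path longest short finA by unfold_locales (auto simp: path_in_rev)
  have "{w \<in> A. E (hd p) w} \<subseteq> (\<lambda>i. p ! Suc i) ` I"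
  proof
    fix w assume w: "w \<in> {w \<in> A. E (hd p) w}"
    then obtain i where i: "i < length p" "w = p ! i"
      using hd_neighbour by (metis (mono_tags, lifting) in_set_conv_nth mem_Collect_eq)
    then have "i \<noteq> 0" using w hd edge_irrefl by (metis (mono_tags, lifting) mem_Collect_eq)
    then show "w \<in> (\<lambda>i. p ! Suc i) ` I"
      using i w hd by (intro image_eqI[of _ _ "i - 1"]) (auto simp: I_def)
  qed
  then have "degree A E (hd p) \<le> card I"
    unfolding degree_def by (rule surj_card_le[rotated]) (simp add: I_def)
  moreover have "{w \<in> A. E (last p) w} \<subseteq> (!) p ` J"
  proof
    fix w assume w: "w \<in> {w \<in> A. E (last p) w}"
    then have "w \<in> set p" using rev.hd_neighbour p_nonempty by (simp add: hd_rev)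
    then obtain i where i: "i < length p" "w = p ! i" by (metis in_set_conv_nth)
    then have "i \<noteq> ?t" using w last edge_irrefl by (metis (mono_tags, lifting) mem_Collect_eq)
    then show "w \<in> (!) p ` J" using i w by (intro image_eqI[of _ _ i]) (auto simp: J_def)
  qed
  then have "degree A E (last p) \<le> card J"
    unfolding degree_def by (rule surj_card_le[rotated]) (simp add: J_def)
  moreover have "card I + card J = card (I \<union> J)"
    using no_crossing by (intro card_Un_disjoint[symmetric]) (auto simp: I_def J_def)
  moreover have "card (I \<union> J) \<le> card {..<?t}"
    by (intro card_mono) (auto simp: I_def J_def)
  moreover have "card {..<?t} < length p" using p_nonempty by simp
  ultimately show ?thesis by linarith
qed

lemma tl_nonempty: "tl p \<noteq> []"
proof
  assume "tl p = []"
  then obtain v where p: "p = [v]" using p_nonempty by (cases p) auto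
  then have "closed_in A E {v}" using path hd_neighbour by (auto simp: closed_in_def path_in_def)
  then have "A = {v}" using conn by (auto simp: connected_in_def)
  then show False using short p by simp
qed

text \<open>All neighbours of the first vertex lie on the rest of the path, which still holds
  together without it. So a closed set either misses the rest of the path and is closed in
  \<open>A\<close> already, or contains all of it and becomes closed in \<open>A\<close> once the
  first vertex is added.\<close>

lemma connected_remove_hd: "connected_in (A - {hd p}) E"
  unfolding connected_in_def
proof (intro allI impI)
  fix S assume S: "closed_in (A - {hd p}) E S" "S \<noteq> {}"
  obtain v q where p: "p = v # q" and q: "q \<noteq> []" using p_nonempty tl_nonempty by (cases p) auto
  have "v \<in> A" "v \<notin> S" using path S p by (auto simp: path_in_def closed_in_def)
  have nb: "w \<in> set q" if "w \<in> A" "E v w" for w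
    using hd_neighbour[of w] that p edge_irrefl by auto
  show "S = A - {hd p}"
  proof (cases "set q \<inter> S = {}")
    case True
    have "closed_in A E S" unfolding closed_in_def
    proof (intro conjI ballI impI)
      fix x w assume x: "x \<in> S" "w \<in> A" "E x w"
      have "x \<in> A" using x S by (auto simp: closed_in_def)
      then have "w \<noteq> v" using nb[of x] x True edge_sym by auto
      then show "w \<in> S" using x S p by (auto simp: closed_in_def)
    qed (use S in \<open>auto simp: closed_in_def\<close>)
    then show ?thesis using S conn \<open>v \<in> A\<close> \<open>v \<notin> S\<close> by (auto simp: connected_in_def)
  next
    case False
    then obtain x where x: "x \<in> set q" "x \<in> S" by blast
    then obtain q1 q2 where q12: "q = q1 @ x # q2" using split_list by metis
    have "path_in (A - {hd p}) E q"
      using path p by (cases q) (auto simp: path_in_def)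
    then have qp: "distinct q" "set q \<subseteq> A - {hd p}" "successively E q" by (auto simp: path_in_def)
    have "path_in (A - {hd p}) E (x # q2)"
      using qp unfolding q12 path_in_def successively_append_iff by auto
    moreover have "path_in (A - {hd p}) E (q1 @ [x])"
      using qp unfolding q12 path_in_def successively_append_iff by (auto simp: successively_Cons)
    then have "path_in (A - {hd p}) E (x # rev q1)" using path_in_rev[of _ "q1 @ [x]"] by simp
    ultimately have "set q \<subseteq> S"
      using closed_in_path[OF S(1) _ x(2)] q12 by fastforce
    then have "closed_in A E (insert v S)"
      using S nb p \<open>v \<in> A\<close> by (auto simp: closed_in_def)
    then have "insert v S = A" using conn by (auto simp: connected_in_def)
    then show ?thesis using p \<open>v \<notin> S\<close> by auto
  qed
qed

text \<open>The two ends of the path are non-adjacent and have few neighbours; if the path misses only one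
  vertex, that vertex is also non-adjacent to one of the second and third vertices of the path.\<close>

lemma degree_sum_le:
  shows "(\<Sum>v\<in>A. degree A E v) \<le> (card A - 1) * (card A - 2)"
    and "card A \<ge> 5 \<Longrightarrow> (\<Sum>v\<in>A. degree A E v) \<le> card A * (card A - 3)"
proof -
  let ?m = "card A" and ?x = "hd p" and ?y = "last p"
  let ?B = "A - {?x} - {?y}"
  have mem: "?x \<in> A" "?y \<in> A" using path p_nonempty by (auto simp: path_in_def)
  have ne: "?x \<noteq> ?y" using path p_nonempty tl_nonempty by (cases p) (auto simp: path_in_def)
  have nadj: "\<not> E ?y ?x" using no_spanning_cycle[OF path] by simp
  have "{w \<in> A - {?x}. E ?y w} = {w \<in> A. E ?y w}" using nadj by auto
  then have "degree (A - {?x}) E ?y = degree A E ?y" by (simp add: degree_def)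
  then have sum: "(\<Sum>v\<in>A. degree A E v)
      = (\<Sum>v\<in>?B. degree ?B E v) + 2 * degree A E ?y + 2 * degree A E ?x"
    using degree_remove[OF finA mem(1)] degree_remove[of "A - {?x}" ?y] finA mem ne by simp
  have len: "length p \<ge> 2" using tl_nonempty by (cases p rule: list.exhaust; cases "tl p") auto
  have cardB: "card ?B = ?m - 2" using finA mem ne by (simp add: card_Diff_singleton_if)
  have m3: "?m \<ge> 3" using len short by simp
  \<comment> \<open>Writing the order as \<open>j + 3\<close> avoids truncated subtraction; removing
    both ends leaves \<open>j + 1\<close> vertices.\<close>
  then obtain j where j: "?m = j + 3" by (metis le_add_diff_inverse add.commute)
  have Bsum: "(\<Sum>v\<in>?B. degree ?B E v) \<le> (j + 1) * j"
    using degree_sum_le_complete[of ?B] finA cardB j by simp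
  show "(\<Sum>v\<in>A. degree A E v) \<le> (?m - 1) * (?m - 2)"
    using sum Bsum end_degrees short j by (simp add: algebra_simps)
  assume m5: "?m \<ge> 5"
  show "(\<Sum>v\<in>A. degree A E v) \<le> ?m * (?m - 3)"
  proof (cases "length p + 2 \<le> ?m")
    case True
    then show ?thesis using sum Bsum end_degrees j by (simp add: algebra_simps)
  next
    case False
    then have t: "length p = j + 2" using short j by simp
    obtain w where w: "w \<in> A" "w \<notin> set p" using ex_missed .
    \<comment> \<open>If \<open>w\<close> were adjacent to both \<open>p ! 1\<close> and
      \<open>p ! 2\<close>, it could be inserted between them. So \<open>i\<close> picks one that is
      not adjacent to \<open>w\<close>; five vertices ensure that it is not an end of
      \<open>p\<close>.\<close>
    define i where "i = (if E (p ! 1) w then 2 else 1 :: nat)"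
    have i: "0 < i" "i < length p - 1" using t m5 j by (auto simp: i_def)
    have notE: "\<not> E (p ! i) w"
    proof
      assume "E (p ! i) w"
      then have e: "E (p ! 1) w" "E (p ! 2) w" by (auto simp: i_def split: if_splits)
      have "path_in A E (take 2 p @ drop 2 p)" using path by simp
      then have "path_in A E (take 2 p @ w # drop 2 p)"
        using w e edge_sym len t m5 j set_take_subset[of 2 p] set_drop_subset[of 2 p]
        unfolding path_in_def successively_append_iff
        by (auto simp: last_conv_nth hd_drop_conv_nth successively_Cons min_def
            simp del: append_take_drop_id)
      then show False using longest by fastforce
    qed
    have d: "distinct p" "set p \<subseteq> A" using path by (auto simp: path_in_def)
    have "p ! i \<noteq> p ! 0" "p ! i \<noteq> p ! (length p - 1)"
      using d i p_nonempty by (simp_all add: nth_eq_iff_index_eq)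
    then have "p ! i \<in> ?B"
      using d i p_nonempty by (auto simp: hd_conv_nth last_conv_nth subset_eq)
    moreover have wB: "w \<in> ?B - {p ! i}" using w p_nonempty i by auto
    ultimately have pB: "p ! i \<in> ?B" "w \<in> ?B - {p ! i}" by auto
    have "degree ?B E (p ! i) \<le> card (?B - {p ! i} - {w})"
      unfolding degree_def using finA notE edge_irrefl by (intro card_mono) auto
    also have "\<dots> = j - 1" using finA cardB pB j by (simp add: card_Diff_singleton_if)
    finally have "degree ?B E (p ! i) \<le> j - 1" .
    moreover have "(\<Sum>v\<in>?B - {p ! i}. degree (?B - {p ! i}) E v) \<le> j * (j - 1)"
      using degree_sum_le_complete[of "?B - {p ! i}"] finA cardB j pB
      by (simp add: card_Diff_singleton_if)
    ultimately have "(\<Sum>v\<in>?B. degree ?B E v) \<le> j * (j - 1) + 2 * (j - 1)"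
      using degree_remove[of ?B "p ! i"] finA pB by simp
    moreover obtain l where "j = Suc l" using m5 j by (cases j) auto
    ultimately show ?thesis using sum end_degrees t j by (simp add: algebra_simps)
  qed
qed

end

section \<open>Erdos-Gallai bounds and alternating paths\<close>

context undirected
begin

text \<open>Induction on the order: an end of a longest path has small degree, and deleting it
  preserves connectivity; \<open>degree_sum_le\<close> settles order \<open>L\<close>. The gain over
  the general bound is the rounding: for \<open>L = 2 * k + 1\<close> the factor is
  \<open>2 * k - 2\<close> instead of \<open>2 * k - 1\<close>.\<close>

lemma connected_no_path_degree_sum:
  assumes "finite A" "connected_in A E" "card A \<ge> L" "L \<ge> 4"
    and "\<And>xs. path_in A E xs \<Longrightarrow> length xs \<noteq> L"
  shows "(\<Sum>v\<in>A. degree A E v) \<le> 2 * ((L - 2) div 2) * card A"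
  using assms(1-3,5)
proof (induction "card A" arbitrary: A)
  case 0
  then show ?case using assms(4) by simp
next
  case (Suc m)
  obtain p where p: "path_in A E p" "\<And>q. path_in A E q \<Longrightarrow> length q \<le> length p"
    using ex_longest_path[OF \<open>finite A\<close>, of E] by blast
  have "length p < L"
  proof (rule ccontr)
    assume "\<not> length p < L"
    then show False using Suc.prems(4)[OF path_in_take[OF p(1), of L]] by simp
  qed
  then interpret longest_path E A p
    using p Suc.prems by unfold_locales auto
  interpret rev: longest_path E A "rev p"
    using p Suc.prems \<open>length p < L\<close> by unfold_locales (auto simp: path_in_rev)
  let ?c = "(L - 2) div 2"
  show ?case
  proof (cases "card A = L")
    case True
    show ?thesis
    proof (cases "L \<ge> 5")
      case L: True
      have "L - 3 \<le> 2 * ?c" by linarith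
      then have "L * (L - 3) \<le> 2 * ?c * L" by (metis mult.commute mult_le_mono2)
      then show ?thesis using degree_sum_le(2) L unfolding True by (metis le_trans)
    next
      case False
      \<comment> \<open>The sharper bound of \<open>degree_sum_le\<close> needs five vertices and
        fails for the star on four; here the first one gives 6, below the required 8.\<close>
      then have "L = 4" using assms(4) by simp
      then show ?thesis using degree_sum_le(1) True by simp
    qed
  next
    case False
    \<comment> \<open>The two end degrees sum to at most \<open>L - 2\<close>, so one of them is at
      most half of that, rounded down.\<close>
    have "degree A E (hd p) \<le> ?c \<or> degree A E (hd (rev p)) \<le> ?c"
      using end_degrees \<open>length p < L\<close> p_nonempty by (simp add: hd_rev) linarith
    then obtain v where v: "degree A E v \<le> ?c" "connected_in (A - {v}) E" "v \<in> A"
      using connected_remove_hd rev.connected_remove_hd path p_nonempty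
      by (metis hd_in_set path_in_def rev.p_nonempty rev.path subsetD)
    have m: "card (A - {v}) = m" using Suc.hyps(2) v(3) Suc.prems(1) by simp
    have "(\<Sum>w\<in>A - {v}. degree (A - {v}) E w) \<le> 2 * ?c * card (A - {v})"
    proof (rule Suc.hyps(1))
      show "L \<le> card (A - {v})" using False Suc.prems(3) Suc.hyps(2) m by simp
      show "length xs \<noteq> L" if "path_in (A - {v}) E xs" for xs
        using Suc.prems(4)[OF path_in_mono[OF that]] by blast
    qed (use m v Suc.prems in auto)
    then show ?thesis
      using degree_remove[OF \<open>finite A\<close> v(3)] v(1) m Suc.hyps(2)[symmetric] by (simp add: algebra_simps)
  qed
qed

lemma degree_closed_in: "closed_in A E C \<Longrightarrow> v \<in> C \<Longrightarrow> degree A E v = degree C E v"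
  unfolding degree_def closed_in_def by (intro arg_cong[of _ _ card]) auto

text \<open>The Erdos-Gallai theorem, summed over components: those with fewer than \<open>L\<close>
  vertices have degrees at most \<open>L - 2\<close>, the others fall under the connected
  case.\<close>

lemma no_path_degree_sum:
  assumes "finite A" "L \<ge> 4" and nopath: "\<And>xs. path_in A E xs \<Longrightarrow> length xs \<noteq> L"
  shows "(\<Sum>v\<in>A. degree A E v) \<le> (L - 2) * card A"
proof -
  define d where "d = degree A E"
  have "(\<Sum>v\<in>A. d v) \<le> (L - 2) * card A"
    using assms(1)
  proof (induction rule: component_induct)
    case (union S T)
    then show ?case by (simp add: sum.union_disjoint card_Un_disjoint algebra_simps)
  next
    case (component C)
    have CA: "C \<subseteq> A" using component(2) by (simp add: closed_in_def)
    then have fin: "finite C" using assms(1) finite_subset by blast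
    have eq: "(\<Sum>v\<in>C. d v) = (\<Sum>v\<in>C. degree C E v)"
      using degree_closed_in[OF component(2)] by (simp add: d_def)
    show ?case
    proof (cases "card C < L")
      case True
      have "degree C E v \<le> L - 2" if "v \<in> C" for v
        using degree_less_card[OF fin that] True by simp
      then show ?thesis using sum_bounded_above[of C "degree C E" "L - 2"] eq by (simp add: mult.commute)
    next
      case False
      have "(\<Sum>v\<in>C. degree C E v) \<le> 2 * ((L - 2) div 2) * card C"
        by (rule connected_no_path_degree_sum)
          (use fin component False assms(2) nopath path_in_mono[OF _ CA] in auto)
      also have "\<dots> \<le> (L - 2) * card C" by (intro mult_le_mono1) linarith
      finally show ?thesis using eq by simp
    qed
  qed simp
  then show ?thesis by (simp add: d_def)
qed

lemma degree_sum_swap: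
  assumes "finite A" "finite B"
  shows "(\<Sum>v\<in>A. degree B E v) = (\<Sum>z\<in>B. degree A E z)"
proof -
  have *: "degree S E v = (\<Sum>z\<in>S. if E v z then 1 else 0)" if "finite S" for S v
    using that by (simp add: degree_def sum.If_cases Int_def)
  have "(\<Sum>v\<in>A. degree B E v) = (\<Sum>z\<in>B. \<Sum>v\<in>A. if E v z then 1 else 0)"
    unfolding *[OF assms(2)] by (rule sum.swap)
  also have "\<dots> = (\<Sum>z\<in>B. degree A E z)"
    unfolding *[OF assms(1)] using edge_sym by (intro sum.cong) auto
  finally show ?thesis .
qed

lemma ex_alternating_path:
  assumes "m > 0" "m \<le> card D" "m \<le> card Z" "\<And>d z. d \<in> D \<Longrightarrow> z \<in> Z \<Longrightarrow> E d z" "d \<in> D"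
  shows "\<exists>xs. path_in (D \<union> Z) E xs \<and> length xs = 2 * m \<and> hd xs = d \<and> last xs \<in> Z"
  using assms
proof (induction m arbitrary: D Z d)
  case (Suc m)
  have "Z \<noteq> {}" using Suc.prems(3) by auto
  then obtain z where z: "z \<in> Z" by blast
  have dz: "E d z" "d \<noteq> z" using Suc.prems(4)[OF Suc.prems(5) z] edge_irrefl by auto
  show ?case
  proof (cases "m = 0")
    case True
    then show ?thesis using dz z Suc.prems(5) by (intro exI[of _ "[d, z]"]) (auto simp: path_in_def)
  next
    case False
    have m: "m \<le> card (D - {d})" "m \<le> card (Z - {z})" using Suc.prems z by simp_all
    then have "D - {d} \<noteq> {}" using False by (metis card.empty le_zero_eq)
    then obtain d' where d': "d' \<in> D - {d}" by blast
    obtain xs where xs: "path_in ((D - {d}) \<union> (Z - {z})) E xs" "length xs = 2 * m"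
        "hd xs = d'" "last xs \<in> Z - {z}"
      using Suc.IH[OF _ m _ d'] False Suc.prems(4) by auto
    have "xs \<noteq> []" using xs(2) False by auto
    moreover have "E z d'" using Suc.prems(4) d' z edge_sym by blast
    \<comment> \<open>Complete adjacency and the absence of loops make \<open>D\<close> and
      \<open>Z\<close> disjoint, so the extended list stays distinct.\<close>
    moreover have "d \<notin> Z" "z \<notin> D" using Suc.prems(4,5) z edge_irrefl by blast+
    ultimately show ?thesis
      using xs dz z Suc.prems(5)
      by (intro exI[of _ "d # z # xs"]) (auto simp: path_in_def successively_Cons)
  qed
qed simp

end

text \<open>Dropping a heaviest element never raises the average, so one drops elements until
  \<open>k\<close> remain. Averages are compared after cross-multiplication.\<close>

lemma ex_light_subset:
  fixes f :: "'a \<Rightarrow> real"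
  assumes "finite B" "k \<le> card B"
  shows "\<exists>Z\<subseteq>B. card Z = k \<and> card B * sum f Z \<le> k * sum f B"
  using assms
proof (induction "card B" arbitrary: B)
  case 0
  then show ?case by auto
next
  case (Suc m)
  show ?case
  proof (cases "k = card B")
    case False
    have "B \<noteq> {}" using Suc.hyps(2) by auto
    obtain y where y: "y \<in> B" "\<And>z. z \<in> B \<Longrightarrow> f z \<le> f y"
      using Max_in[of "f ` B"] Max_ge[of "f ` B"] \<open>B \<noteq> {}\<close> Suc.prems(1) by fastforce
    have m: "m = card (B - {y})" using y Suc by simp
    have km: "k \<le> card (B - {y})" using False Suc.prems Suc.hyps(2) m by simp
    obtain Z where Z: "Z \<subseteq> B - {y}" "card Z = k" "card (B - {y}) * sum f Z \<le> k * sum f (B - {y})"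
      using Suc.hyps(1)[OF m _ km] Suc.prems(1) by auto
    have sumB: "sum f B = f y + sum f (B - {y})" using y Suc.prems by (simp add: sum.remove)
    have "sum f B \<le> card B * f y" using sum_bounded_above[of B f "f y"] y by simp
    then have avg: "card B * sum f (B - {y}) \<le> m * sum f B"
      using sumB Suc.hyps(2)[symmetric] by (simp add: algebra_simps)
    show ?thesis
    proof (cases "m = 0")
      case True
      then have "k = 0" using km m by simp
      then show ?thesis by (intro exI[of _ "{}"]) simp
    next
      case False
      have "m * (card B * sum f Z) = card B * (m * sum f Z)" by simp
      also have "\<dots> \<le> card B * (k * sum f (B - {y}))"
        using Z(3) m by (intro mult_left_mono) auto
      also have "\<dots> = k * (card B * sum f (B - {y}))" by simp
      also have "\<dots> \<le> k * (m * sum f B)" using avg by (intro mult_left_mono) auto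
      finally have "m * (card B * sum f Z) \<le> m * (k * sum f B)" by (simp add: mult.left_commute)
      then have "card B * sum f Z \<le> k * sum f B" using False by simp
      then show ?thesis using Z by blast
    qed
  qed auto
qed

section \<open>Weights bounded by the degrees\<close>

text \<open>The weight \<open>r\<close> is the modulus of an eigenvector, scaled so that \<open>r v\<close> is at most the degree
  of \<open>v\<close>, with equality at the tight vertices.\<close>

locale degree_bounded_weight = undirected +
  fixes V :: "'a set" and k :: nat and r :: "'a \<Rightarrow> real"
  assumes finV: "finite V"
    and edge_V: "E u v \<Longrightarrow> v \<in> V"
    and k2: "k \<ge> 2"
    and large: "card V > 6 * k ^ 2"
    and r_le: "v \<in> V \<Longrightarrow> r v \<le> degree V E v"
    and r_nonneg: "r v \<ge> 0"
    and subinv: "v \<in> V \<Longrightarrow>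
      (card V + 2 * k - 2) * r v \<le> degree V E v * r v + (\<Sum>w | w \<in> V \<and> E v w. r w)"
begin

section \<open>The neighbourhood of a tight vertex\<close>

definition nbr where "nbr u = {w \<in> V. E u w}"
definition far where "far u = V - nbr u - {u}"
definition tight where "tight u \<longleftrightarrow> u \<in> V \<and> degree V E u > 0 \<and> r u = degree V E u"

lemma fin [simp]: "finite (nbr u)" "finite (far u)"
  using finV by (auto simp: nbr_def far_def)

lemma degree_nbr: "degree V E u = card (nbr u)"
  by (simp add: degree_def nbr_def)

lemma V_split: "u \<in> V \<Longrightarrow> V = insert u (nbr u \<union> far u)" "u \<notin> nbr u" "u \<notin> far u" "nbr u \<inter> far u = {}"
  using edge_irrefl by (auto simp: nbr_def far_def)

lemma card_V: "u \<in> V \<Longrightarrow> card V = Suc (card (nbr u) + card (far u))"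
  using V_split[of u] by (metis card_Un_disjoint card_insert_disjoint fin finite_UnI UnE)

text \<open>The summand stays general because the split serves both for degrees, with constant 1,
  and for the weight \<open>r\<close>.\<close>

lemma sum_nbr_split:
  assumes "u \<in> V" "v \<in> nbr u"
  shows "(\<Sum>w\<in>nbr v. f w) = f u + (\<Sum>w\<in>{w \<in> nbr u. E v w}. f w) + (\<Sum>w\<in>{w \<in> far u. E v w}. f w)"
proof -
  have "E v u" using assms edge_sym by (auto simp: nbr_def)
  then have "nbr v = insert u ({w \<in> nbr u. E v w} \<union> {w \<in> far u. E v w})"
    using assms edge_V by (auto simp: nbr_def far_def)
  moreover have "u \<notin> {w \<in> nbr u. E v w} \<union> {w \<in> far u. E v w}" using V_split by auto
  moreover have "{w \<in> nbr u. E v w} \<inter> {w \<in> far u. E v w} = {}" using V_split(4)[of u] by auto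
  ultimately show ?thesis by (simp add: sum.union_disjoint add.assoc)
qed

lemma degree_split:
  assumes "u \<in> V" "v \<in> nbr u"
  shows "degree V E v = 1 + degree (nbr u) E v + degree (far u) E v"
  using sum_nbr_split[OF assms, of "\<lambda>_. 1 :: nat"] unfolding degree_nbr by (simp add: degree_def)

lemma degree_far_le: "degree (far u) E v \<le> card (far u)"
  unfolding degree_def by (intro card_mono) auto

lemma tight_weight_sum:
  assumes "tight u"
  shows "(card (far u) + 2 * k - 1) * card (nbr u) \<le> (\<Sum>v\<in>nbr u. r v)"
proof -
  have u: "u \<in> V" "r u = card (nbr u)" using assms by (auto simp: tight_def degree_nbr)
  have "(card V + 2 * k - 2) * real (card (nbr u)) \<le> card (nbr u) * real (card (nbr u)) + (\<Sum>v\<in>nbr u. r v)"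
    using subinv[OF u(1)] u degree_nbr by (simp add: nbr_def)
  \<comment> \<open>Since \<open>card V\<close> is \<open>a + b + 1\<close>, the factor on the left
    is \<open>c + a\<close>; the product \<open>a * a\<close> then cancels.\<close>
  moreover define c where "c = card (far u) + 2 * k - 1"
  then have "card V + 2 * k - 2 = c + card (nbr u)"
    using card_V[OF u(1)] k2 by simp
  ultimately have "real (c * card (nbr u)) \<le> (\<Sum>v\<in>nbr u. r v)" by (simp add: algebra_simps)
  then show ?thesis by (simp add: c_def)
qed

lemma tight_degree_sum:
  assumes "tight u"
  shows "(card (far u) + 2 * k - 1) * card (nbr u) \<le> (\<Sum>v\<in>nbr u. degree V E v)"
proof -
  have "(\<Sum>v\<in>nbr u. r v) \<le> (\<Sum>v\<in>nbr u. real (degree V E v))"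
    by (intro sum_mono r_le) (auto simp: nbr_def)
  then have "real ((card (far u) + 2 * k - 1) * card (nbr u)) \<le> real (\<Sum>v\<in>nbr u. degree V E v)"
    using tight_weight_sum[OF assms] by simp
  then show ?thesis by linarith
qed

lemma nbr_degree_sum:
  assumes "u \<in> V"
  shows "(\<Sum>v\<in>nbr u. degree V E v) = card (nbr u) + (\<Sum>v\<in>nbr u. degree (nbr u) E v)
    + (\<Sum>v\<in>nbr u. degree (far u) E v)"
  using degree_split[OF assms] by (simp add: sum.distrib del: add_Suc flip: Suc_eq_plus1_left)

text \<open>Degrees on the neighbourhood average at least \<open>b + 2 * k - 1\<close>, but none
  exceeds \<open>card V - 1\<close>, which is \<open>a + b\<close>.\<close>

lemma tight_card_nbr:
  assumes "tight u"
  shows "card (nbr u) \<ge> 2 * k - 1"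
proof -
  have u: "u \<in> V" "card (nbr u) > 0" using assms by (auto simp: tight_def degree_nbr)
  have "degree V E v \<le> card V - 1" if "v \<in> nbr u" for v
    using degree_less_card[OF finV, of v] that by (auto simp: nbr_def)
  then have "(\<Sum>v\<in>nbr u. degree V E v) \<le> (card V - 1) * card (nbr u)"
    using sum_bounded_above[of "nbr u" "degree V E" "card V - 1"] by (simp add: mult.commute)
  then have "card (far u) + 2 * k - 1 \<le> card V - 1"
    using tight_degree_sum[OF assms] u(2) by (meson le_trans mult_le_cancel2)
  then show ?thesis using card_V[OF u(1)] by simp
qed

lemma cycle_through:
  assumes "u \<in> V" "path_in (nbr u) E xs" "xs \<noteq> []"
  shows "has_cycle V E (Suc (length xs))"
proof -
  have "hd xs \<in> nbr u" "last xs \<in> nbr u" using assms by (auto simp: path_in_def)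
  then have "E u (hd xs)" "E (last xs) u" using edge_sym by (auto simp: nbr_def)
  moreover have "u \<notin> set xs" using assms V_split(2) by (auto simp: path_in_def)
  ultimately have "path_in V E (u # xs)"
    using assms by (auto simp: path_in_def successively_Cons nbr_def)
  then show ?thesis using has_cycleI[of V E "u # xs"] assms \<open>E (last xs) u\<close> by simp
qed

text \<open>Without the cycle, \<open>A\<close> has no path on \<open>2 * k + 1\<close> vertices, so
  at most \<open>a\<close> pairs between \<open>A\<close> and \<open>B\<close> are non-adjacent.
  Then some \<open>k\<close> far vertices have at least \<open>k + 1\<close> common neighbours in
  \<open>A\<close>; together with \<open>u\<close> they carry an alternating cycle.\<close>

lemma far_large_even:
  assumes "tight u" "card (far u) \<ge> 2 * k"
  shows "has_cycle V E (2 * k + 2)"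
proof (rule ccontr)
  assume nocycle: "\<not> ?thesis"
  define A B where "A = nbr u" and "B = far u"
  define a b where "a = card A" and "b = card B"
  have u: "u \<in> V" using assms by (simp add: tight_def)
  have fin': "finite A" "finite B" by (simp_all add: A_def B_def)
  have "(\<Sum>v\<in>A. degree A E v) \<le> (2 * k + 1 - 2) * a"
    unfolding a_def
  proof (rule no_path_degree_sum)
    show "length xs \<noteq> 2 * k + 1" if "path_in A E xs" for xs
      using cycle_through[OF u that[unfolded A_def]] nocycle by fastforce
  qed (use k2 fin' in auto)
  moreover have "(b + 2 * k - 1) * a \<le> a + (\<Sum>v\<in>A. degree A E v) + (\<Sum>v\<in>A. degree B E v)"
    using tight_degree_sum[OF assms(1)] nbr_degree_sum[OF u] by (simp add: A_def B_def a_def b_def)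
  moreover have "(b + 2 * k - 1) * a = b * a + (2 * k - 1) * a"
    using k2 by (simp add: algebra_simps)
  ultimately have cross: "b * a \<le> a + (\<Sum>z\<in>B. degree A E z)"
    using degree_sum_swap[OF fin'] by simp
  define f where "f z = card {v \<in> A. \<not> E z v}" for z
  have f: "f z + degree A E z = a" for z
  proof -
    have "A = {v \<in> A. \<not> E z v} \<union> {v \<in> A. E z v}" by auto
    then have "a = card ({v \<in> A. \<not> E z v} \<union> {v \<in> A. E z v})" unfolding a_def by simp
    also have "\<dots> = f z + degree A E z"
      unfolding f_def degree_def by (rule card_Un_disjoint) (use fin' in auto)
    finally show ?thesis by simp
  qed
  have "(\<Sum>z\<in>B. f z) + (\<Sum>z\<in>B. degree A E z) = b * a"
    using f by (simp add: b_def flip: sum.distrib)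
  then have fB: "(\<Sum>z\<in>B. f z) \<le> a" using cross by simp
  \<comment> \<open>The \<open>k\<close> far vertices are chosen to miss few vertices of
    \<open>A\<close>: together at most \<open>k * a / b\<close>.\<close>
  obtain Z where Z: "Z \<subseteq> B" "card Z = k" "b * (\<Sum>z\<in>Z. real (f z)) \<le> k * (\<Sum>z\<in>B. real (f z))"
    using ex_light_subset[OF fin'(2), of k "\<lambda>z. real (f z)"] assms(2) by (auto simp: B_def b_def)
  have finZ: "finite Z" using Z fin' finite_subset by blast
  have "real (b * (\<Sum>z\<in>Z. f z)) \<le> real (k * (\<Sum>z\<in>B. f z))" using Z(3) by simp
  then have "b * (\<Sum>z\<in>Z. f z) \<le> k * (\<Sum>z\<in>B. f z)" by (rule of_nat_le_iff[THEN iffD1])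
  also have "\<dots> \<le> k * a" using fB by simp
  finally have fZ: "b * (\<Sum>z\<in>Z. f z) \<le> k * a" .
  define D where "D = {v \<in> A. \<forall>z\<in>Z. E z v}"
  have "A - D \<subseteq> (\<Union>z\<in>Z. {v \<in> A. \<not> E z v})" by (auto simp: D_def)
  then have "card (A - D) \<le> card (\<Union>z\<in>Z. {v \<in> A. \<not> E z v})"
    using fin' finZ by (intro card_mono) auto
  also have "\<dots> \<le> (\<Sum>z\<in>Z. f z)" unfolding f_def by (rule card_UN_le[OF finZ])
  finally have "a \<le> card D + (\<Sum>z\<in>Z. f z)"
    using card_Diff_subset[of D A] fin' by (simp add: D_def a_def)
  then have "b * a \<le> b * card D + b * (\<Sum>z\<in>Z. f z)" by (metis add_mult_distrib2 mult_le_mono2)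
  then have D: "b * a \<le> b * card D + k * a" using fZ by simp
  have n: "6 * k ^ 2 \<le> a + b" using large card_V[OF u] by (simp add: a_def b_def A_def B_def)
  have a: "a \<ge> 2 * k - 1" using tight_card_nbr[OF assms(1)] by (simp add: a_def A_def)
  have b: "b \<ge> 2 * k" using assms(2) by (simp add: b_def B_def)
  have "Suc k \<le> card D"
  proof (rule ccontr)
    assume "\<not> Suc k \<le> card D"
    then have "b * card D \<le> b * k" by (intro mult_le_mono2) simp
    then have bak: "b * a \<le> b * k + k * a" using D by linarith
    \<comment> \<open>The inequality \<open>bak\<close> reads
      \<open>(a - k) * (b - k) \<le> k * k\<close>, which fails for \<open>a > 2 * k\<close> and
      \<open>b \<ge> 2 * k\<close>. If \<open>a \<le> 2 * k\<close>, then
      \<open>n > 6 * k ^ 2\<close> forces \<open>b \<ge> 4 * k ^ 2\<close>, while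
      \<open>a \<ge> 2 * k - 1\<close> gives
      \<open>b * (k - 1) \<le> k * a \<le> 2 * k ^ 2\<close>.\<close>
    obtain b' where b': "b = 2 * k + b'" using b le_Suc_ex by blast
    show False
    proof (cases "a \<ge> 2 * k + 1")
      case True
      then obtain a' where a': "a = 2 * k + 1 + a'" using le_Suc_ex by blast
      show False using bak k2 unfolding a' b' by (simp add: algebra_simps)
    next
      case False
      obtain l where l: "k = Suc l" "l > 0" using k2 by (cases k) auto
      have "2 * k \<le> 2 * k\<^sup>2" by (simp add: power2_eq_square)
      then have "4 * k\<^sup>2 \<le> b" using n False by linarith
      also have "b \<le> b * l" using l by simp
      also have "b * l + b * k = b * (2 * k - 1)" using l by (simp add: algebra_simps)
      then have "b * l \<le> k * a" using bak a mult_le_mono2[OF a, of b] by linarith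
      also have "k * a \<le> k * (2 * k)" using False by (intro mult_le_mono2) simp
      finally show False using k2 by (simp add: power2_eq_square)
    qed
  qed
  then obtain d where d: "d \<in> D" by fastforce
  have uZ: "u \<notin> Z" using Z(1) V_split(3) by (auto simp: B_def)
  have "\<exists>xs. path_in (D \<union> insert u Z) E xs \<and> length xs = 2 * Suc k \<and> hd xs = d \<and> last xs \<in> insert u Z"
  proof (rule ex_alternating_path)
    show "E y z" if "y \<in> D" "z \<in> insert u Z" for y z
      using that edge_sym by (auto simp: D_def A_def nbr_def)
  qed (use \<open>Suc k \<le> card D\<close> d Z uZ finZ in auto)
  then obtain xs where xs: "path_in (D \<union> insert u Z) E xs" "length xs = 2 * Suc k" "hd xs = d"
    "last xs \<in> insert u Z" by blast
  have "D \<union> insert u Z \<subseteq> V" using u Z by (auto simp: D_def A_def B_def nbr_def far_def)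
  then have "path_in V E xs" using xs(1) path_in_mono by blast
  moreover have "xs \<noteq> []" using xs(2) by auto
  moreover have "E (last xs) (hd xs)" using xs(3,4) d by (auto simp: D_def A_def nbr_def)
  ultimately show False using has_cycleI xs(2) nocycle by fastforce
qed

text \<open>Excluding paths on \<open>2 * k\<close> vertices in \<open>A\<close> leaves no slack in
  the degree count: \<open>A\<close> and \<open>B\<close> are completely joined, and
  \<open>A\<close> contains an edge \<open>x y\<close>. An alternating path from \<open>y\<close>
  that avoids \<open>x\<close> and ends outside \<open>A\<close> closes up through \<open>x\<close>,
  which gives odd length.\<close>

lemma far_large_odd:
  assumes "tight u" "card (far u) \<ge> 2 * k"
  shows "has_cycle V E (2 * k + 1)"
proof (rule ccontr)
  assume nocycle: "\<not> ?thesis"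
  let ?A = "nbr u" and ?B = "far u"
  have u: "u \<in> V" using assms by (simp add: tight_def)
  have a: "card ?A \<ge> 2 * k - 1" by (rule tight_card_nbr[OF assms(1)])
  have "(\<Sum>v\<in>?A. degree ?A E v) \<le> (2 * k - 2) * card ?A"
  proof (rule no_path_degree_sum)
    show "length xs \<noteq> 2 * k" if "path_in ?A E xs" for xs
      using cycle_through[OF u that] nocycle k2 by fastforce
  qed (use k2 in auto)
  moreover have "(card ?B + 2 * k - 1) * card ?A
      = card ?A + (2 * k - 2) * card ?A + card ?A * card ?B"
    using k2 by (simp add: algebra_simps flip: add_mult_distrib)
  moreover have le: "(\<Sum>v\<in>?A. degree ?B E v) \<le> (\<Sum>v\<in>?A. card ?B)"
    by (intro sum_mono degree_far_le)
  ultimately have eq: "(\<Sum>v\<in>?A. degree ?A E v) = (2 * k - 2) * card ?A"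
      "(\<Sum>v\<in>?A. degree ?B E v) = (\<Sum>v\<in>?A. card ?B)"
    using tight_degree_sum[OF assms(1)] nbr_degree_sum[OF u] by simp_all
  have complete: "E v z" if "v \<in> ?A" "z \<in> ?B" for v z
  proof -
    have "degree ?B E v = card ?B"
      using sum_mono_inv[OF eq(2) degree_far_le] that by simp
    then have "{z \<in> ?B. E v z} = ?B" unfolding degree_def by (intro card_subset_eq) auto
    then show ?thesis using that by blast
  qed
  have "(\<Sum>v\<in>?A. degree ?A E v) > 0" unfolding eq(1) using a k2 by (intro mult_pos_pos) linarith+
  then obtain y where y: "y \<in> ?A" "degree ?A E y \<noteq> 0" by (metis less_irrefl sum.neutral)
  then have "{w \<in> ?A. E y w} \<noteq> {}" by (metis card.empty degree_def)
  then obtain x where x: "x \<in> ?A" "E y x" by blast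
  then have "E x y" using edge_sym by blast
  let ?D = "?A - {x}" and ?Z = "insert u ?B"
  have Z: "E v z" if "v \<in> ?A" "z \<in> ?Z" for v z
  proof (cases "z = u")
    case True
    then show ?thesis using that(1) by (auto simp: nbr_def intro: edge_sym)
  next
    case False
    then show ?thesis using that complete by blast
  qed
  have "\<exists>xs. path_in (?D \<union> ?Z) E xs \<and> length xs = 2 * k \<and> hd xs = y \<and> last xs \<in> ?Z"
  proof (rule ex_alternating_path)
    show "k \<le> card ?D" using a k2 x(1) by simp
    show "k \<le> card ?Z" using assms(2) V_split(3) by simp
    show "y \<in> ?D" using y x edge_irrefl by auto
    show "k > 0" using k2 by simp
    show "E v z" if "v \<in> ?D" "z \<in> ?Z" for v z using Z[of v z] that by blast
  qed
  then obtain xs where xs: "path_in (?D \<union> ?Z) E xs" "length xs = 2 * k" "hd xs = y"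
    "last xs \<in> ?Z" by blast
  have ne: "xs \<noteq> []" using xs(2) k2 by auto
  have "x \<notin> ?Z" using Z[of x x] x edge_irrefl by blast
  then have "x \<notin> set xs" using xs(1) by (auto simp: path_in_def)
  moreover have "(?D \<union> ?Z) \<subseteq> V" "x \<in> V" using u x(1) by (auto simp: nbr_def far_def)
  ultimately have "path_in V E (x # xs)"
    using xs(1,3) ne \<open>E x y\<close> by (auto simp: path_in_def successively_Cons)
  moreover have "E (last (x # xs)) x" using ne edge_sym[OF Z[OF x(1) xs(4)]] by simp
  ultimately have "has_cycle V E (length (x # xs))" by (intro has_cycleI) auto
  then show False using nocycle xs(2) by simp
qed

section \<open>Few far vertices: tightness spreads to the neighbourhood\<close>

lemma far_small_tight:
  assumes "tight u" "card (far u) < 2 * k" "\<And>xs. path_in (nbr u) E xs \<Longrightarrow> length xs \<noteq> 2 * k + 1"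
    and "v \<in> nbr u"
  shows "tight v"
proof -
  define A B where "A = nbr u" and "B = far u"
  define a b where "a = card A" and "b = card B"
  define t where "t = b + 2 * k - 1"
  have u: "u \<in> V" using assms by (simp add: tight_def)
  have fin': "finite A" "finite B" by (simp_all add: A_def B_def)
  have nV: "card V = Suc (a + b)" using card_V[OF u] by (simp add: a_def b_def A_def B_def)
  \<comment> \<open>From \<open>n > 6 * k ^ 2\<close> and \<open>b \<le> 2 * k - 1\<close> follow
    \<open>a \<ge> 6 * k ^ 2 - 2 * k + 1\<close> and \<open>t \<le> 4 * k - 2\<close>. Substituting
    \<open>k = l + 2\<close> leaves polynomials with nonnegative coefficients.\<close>
  have a_large: "b * (b - 1) + 2 * k * t < (2 * k - 2) * a"
  proof -
    obtain l where l: "k = l + 2" using k2 by (metis add.commute le_Suc_ex)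
    have b: "b \<le> 2 * l + 3" using assms(2) l by (simp add: b_def B_def)
    then have t: "t \<le> 4 * l + 6" by (simp add: t_def l)
    have "6 * l * l + 22 * l + 21 \<le> a"
      using large nV b by (simp add: l power2_eq_square algebra_simps)
    then have "(2 * l + 2) * (6 * l * l + 22 * l + 21) \<le> (2 * l + 2) * a" by (rule mult_le_mono2)
    moreover have "b * (b - 1) + 2 * k * t \<le> (2 * l + 3) * (2 * l + 2) + 2 * (l + 2) * (4 * l + 6)"
      using b t l by (intro add_mono mult_mono) auto
    moreover have "(2 * l + 3) * (2 * l + 2) + 2 * (l + 2) * (4 * l + 6)
        < (2 * l + 2) * (6 * l * l + 22 * l + 21)"
      by (simp add: algebra_simps)
    ultimately show ?thesis by (simp add: l)
  qed
  \<comment> \<open>This property is additive over components and keeps track of equality. On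
    \<open>A\<close>, the reverse inequality \<open>tight_weight_sum\<close> then forces
    \<open>r\<close> to equal the degree everywhere.\<close>
  define strict where "strict C \<longleftrightarrow> (\<Sum>v\<in>C. r v) \<le> t * card C \<and>
    ((\<Sum>v\<in>C. r v) = t * card C \<longrightarrow> (\<forall>v\<in>C. r v = degree V E v))" for C
  have "strict A"
    using fin'(1)
  proof (induction rule: component_induct)
    case empty
    then show ?case by (simp add: strict_def)
  next
    case (union S T)
    have sum: "(\<Sum>v\<in>S \<union> T. r v) = (\<Sum>v\<in>S. r v) + (\<Sum>v\<in>T. r v)"
      using union by (simp add: sum.union_disjoint)
    have card: "real (t * card (S \<union> T)) = real (t * card S) + real (t * card T)"
      using union by (simp add: card_Un_disjoint algebra_simps)
    have S: "strict S" and T: "strict T" by fact+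
    have le: "(\<Sum>v\<in>S. r v) \<le> real (t * card S)" "(\<Sum>v\<in>T. r v) \<le> real (t * card T)"
      using S T unfolding strict_def by blast+
    show ?case unfolding strict_def
    proof (intro conjI impI ballI)
      show "(\<Sum>v\<in>S \<union> T. r v) \<le> real (t * card (S \<union> T))" using sum card le by linarith
      fix v assume eq: "(\<Sum>v\<in>S \<union> T. r v) = real (t * card (S \<union> T))" and v: "v \<in> S \<union> T"
      have "(\<Sum>v\<in>S. r v) = real (t * card S)" "(\<Sum>v\<in>T. r v) = real (t * card T)"
        using eq sum card le by linarith+
      then show "r v = degree V E v" using S T v unfolding strict_def by blast
    qed
  next
    case (component C)
    have CA: "C \<subseteq> A" using component(2) by (simp add: closed_in_def)
    then have fC: "finite C" using fin' finite_subset by blast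
    have CV: "v \<in> V" "v \<in> nbr u" if "v \<in> C" for v using that CA by (auto simp: A_def nbr_def)
    have dA: "degree A E v = degree C E v" if "v \<in> C" for v
      using degree_closed_in[OF component(2) that] .
    have dV: "degree V E v \<le> 1 + degree C E v + b" if "v \<in> C" for v
      using degree_split[OF u CV(2)[OF that]] degree_far_le[of u v] dA[OF that]
      by (simp add: A_def B_def b_def)
    show ?case
    proof (cases "card C \<le> 2 * k")
      case True
      \<comment> \<open>The weight inequality is applied where \<open>r\<close> is largest on
        \<open>C\<close>. The neighbours there are \<open>u\<close> of weight \<open>a\<close>, at
        most \<open>2 * k - 1\<close> vertices of \<open>C\<close> of weight at most
        \<open>M\<close>, and at most \<open>b\<close> far ones. A far vertex misses itself and
        \<open>u\<close>, so its weight is at most \<open>a + b - 1\<close>.\<close>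
      define M where "M = Max (r ` C)"
      have rM: "r v \<le> M" if "v \<in> C" for v using that fC by (simp add: M_def)
      have "M \<in> r ` C" unfolding M_def using fC component(1) by (intro Max_in) auto
      then obtain v where v: "v \<in> C" "r v = M" by auto
      have M0: "M \<ge> 0" using v r_nonneg by metis
      have vC: "{w \<in> A. E v w} \<subseteq> C" using component(2) v by (auto simp: closed_in_def)
      have dC: "degree C E v \<le> 2 * k - 1" using degree_less_card[OF fC v(1)] True by simp
      have "(\<Sum>w\<in>{w \<in> A. E v w}. r w) \<le> (\<Sum>w\<in>{w \<in> A. E v w}. M)"
        using vC rM by (intro sum_mono) auto
      also have "\<dots> = degree C E v * M" using dA[OF v(1)] by (simp add: degree_def)
      also have "\<dots> \<le> real (2 * k - 1) * M" using dC M0 by (intro mult_right_mono) auto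
      finally have sumA: "(\<Sum>w\<in>{w \<in> A. E v w}. r w) \<le> real (2 * k - 1) * M" .
      have rB: "r w \<le> a + b - 1" if w: "w \<in> B" for w
      proof -
        have "nbr w \<subseteq> V - {u} - {w}"
          using w edge_sym edge_irrefl by (auto simp: nbr_def B_def far_def)
        then have "degree V E w \<le> card (V - {u} - {w})"
          unfolding degree_nbr using finV by (intro card_mono) auto
        also have "\<dots> = a + b - 1" using w u nV finV by (auto simp: B_def far_def)
        finally show ?thesis using r_le[of w] w by (fastforce simp: B_def far_def)
      qed
      have "(\<Sum>w\<in>{w \<in> B. E v w}. r w) \<le> (\<Sum>w\<in>{w \<in> B. E v w}. real (a + b - 1))"
        using rB by (intro sum_mono) auto
      also have "\<dots> = degree B E v * real (a + b - 1)" by (simp add: degree_def)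
      also have "\<dots> \<le> b * real (a + b - 1)"
        using degree_far_le[of u v] by (intro mult_right_mono) (auto simp: b_def B_def)
      finally have sumB: "(\<Sum>w\<in>{w \<in> B. E v w}. r w) \<le> b * real (a + b - 1)" .
      have "degree V E v * M \<le> real (2 * k + b) * M"
        using dV[OF v(1)] dC k2 M0 by (intro mult_right_mono) auto
      moreover have "r u = a" using assms(1) by (simp add: tight_def degree_nbr a_def A_def)
      ultimately have "real (card V + 2 * k - 2) * M
          \<le> real (2 * k + b) * M + (a + real (2 * k - 1) * M + b * real (a + b - 1))"
        using subinv[OF CV(1)[OF v(1)]] sum_nbr_split[OF u CV(2)[OF v(1)], of r] sumA sumB v(2)
        by (simp add: A_def B_def nbr_def)
      moreover have "real (card V + 2 * k - 2) = a + b + 2 * real k - 1"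
        "real (2 * k - 1) = 2 * real k - 1"
        using nV k2 by (auto simp: of_nat_diff)
      ultimately have "(a + b + 2 * real k - 1) * M
          \<le> real (2 * k + b) * M + (a + (2 * real k - 1) * M + b * real (a + b - 1))"
        by metis
      then have M: "(real a - 2 * k) * M \<le> a + b * real (a + b - 1)"
        by (simp add: algebra_simps)
      \<comment> \<open>Putting \<open>t\<close> for \<open>M\<close>, the left side exceeds the
        right by \<open>(2 * k - 2) * a - b * (b - 1) - 2 * k * t\<close>, which is positive by
        \<open>a_large\<close>; hence \<open>M < t\<close>.\<close>
      define c where "c = b * (b - 1)"
      have "real (c + 2 * k * t) < real ((2 * k - 2) * a)"
        using a_large unfolding c_def by (simp only: of_nat_less_iff)
      then have "real c + 2 * real k * t < (2 * real k - 2) * a" using k2 by (simp add: of_nat_diff)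
      moreover have "b * real (a + b - 1) = real b * a + c"
        by (cases b) (auto simp: c_def algebra_simps)
      moreover have t: "real t = b + 2 * real k - 1" using k2 by (simp add: t_def of_nat_diff)
      have "a * real t = a * real b + 2 * (a * real k) - a"
        unfolding t by (simp add: algebra_simps)
      ultimately have "a + b * real (a + b - 1) < (real a - 2 * k) * t"
        by (simp add: algebra_simps)
      then have prod: "(real a - 2 * k) * M < (real a - 2 * k) * t" using M by linarith
      have "(2 * k - 2) * (2 * k) = 2 * k * (2 * k - 2)" by (rule mult.commute)
      also have "\<dots> \<le> 2 * k * t" by (intro mult_le_mono2) (simp add: t_def)
      also have "\<dots> \<le> b * (b - 1) + 2 * k * t" by (rule le_add2)
      also note a_large
      finally have "2 * k < a" by (simp only: mult_less_cancel1)
      then have "M < t" using prod by simp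
      then have "(\<Sum>v\<in>C. r v) < (\<Sum>v\<in>C. real t)"
        using rM by (intro sum_strict_mono fC component(1)) fastforce
      then show ?thesis by (simp add: strict_def mult.commute)
    next
      case False
      \<comment> \<open>On average a vertex of \<open>C\<close> has at most \<open>2 * k - 2\<close>
        neighbours in \<open>C\<close>; adding 1 for \<open>u\<close> and at most \<open>b\<close>
        far ones gives exactly \<open>t\<close>.\<close>
      have "(\<Sum>v\<in>C. degree C E v) \<le> 2 * ((2 * k + 1 - 2) div 2) * card C"
        by (rule connected_no_path_degree_sum)
          (use fC component False k2 assms(3) path_in_mono[OF _ CA] in \<open>auto simp: A_def\<close>)
      also have "2 * ((2 * k + 1 - 2) div 2) = 2 * k - 2" using k2 by simp
      finally have "(\<Sum>v\<in>C. degree C E v) \<le> (2 * k - 2) * card C" .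
      moreover have "(\<Sum>v\<in>C. degree V E v) \<le> (\<Sum>v\<in>C. 1 + degree C E v + b)"
        by (intro sum_mono dV)
      moreover have "(\<Sum>v\<in>C. 1 + degree C E v + b) = (\<Sum>v\<in>C. degree C E v) + (1 + b) * card C"
        unfolding sum.distrib by (simp add: algebra_simps)
      moreover have "(2 * k - 2) + (1 + b) = t" using k2 by (simp add: t_def)
      then have "(2 * k - 2) * card C + (1 + b) * card C = t * card C"
        by (metis add_mult_distrib)
      ultimately have "(\<Sum>v\<in>C. degree V E v) \<le> t * card C" by linarith
      then have le: "(\<Sum>v\<in>C. real (degree V E v)) \<le> t * card C"
        by (metis of_nat_le_iff of_nat_sum)
      have rd: "r v \<le> degree V E v" if "v \<in> C" for v using r_le CV that by blast
      then have le': "(\<Sum>v\<in>C. r v) \<le> (\<Sum>v\<in>C. real (degree V E v))" by (intro sum_mono)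
      have "r v = degree V E v" if "(\<Sum>v\<in>C. r v) = t * card C" "v \<in> C" for v
      proof (rule sum_mono_inv[of r C "\<lambda>v. real (degree V E v)"])
        show "(\<Sum>v\<in>C. r v) = (\<Sum>v\<in>C. real (degree V E v))" using le le' that(1) by simp
      qed (use rd that fC in auto)
      then show ?thesis using order_trans[OF le' le] unfolding strict_def by blast
    qed
  qed
  moreover have "t * a \<le> (\<Sum>v\<in>A. r v)"
    using tight_weight_sum[OF assms(1)] by (simp add: t_def a_def b_def A_def B_def)
  ultimately have "\<forall>v\<in>A. r v = degree V E v"
    unfolding strict_def a_def by (meson order_antisym)
  then have "r v = degree V E v" using assms(4) by (simp add: A_def)
  moreover have "v \<in> V" "u \<in> nbr v" using assms(4) u edge_sym by (auto simp: nbr_def)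
  ultimately show ?thesis by (auto simp: tight_def degree_nbr card_gt_0_iff)
qed

text \<open>If the path were missing, every neighbour of \<open>u\<close> would be tight and so miss
  few vertices of the graph. Each would have at least \<open>2 * k\<close> neighbours inside the
  neighbourhood of \<open>u\<close>, while Erdos-Gallai allows an average of
  \<open>2 * k - 1\<close>.\<close>

lemma far_small:
  assumes "tight u" "\<And>v. tight v \<Longrightarrow> card (far v) < 2 * k"
  shows "\<exists>xs. path_in (nbr u) E xs \<and> length xs = 2 * k + 1"
proof (rule ccontr)
  assume nopath: "\<not> ?thesis"
  let ?A = "nbr u"
  have u: "u \<in> V" "card ?A > 0" using assms by (auto simp: tight_def degree_nbr)
  have "(\<Sum>v\<in>?A. degree ?A E v) \<le> (2 * k + 1 - 2) * card ?A"
    by (rule no_path_degree_sum) (use nopath k2 in auto)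
  moreover have "2 * k \<le> degree ?A E v" if v: "v \<in> ?A" for v
  proof -
    have "tight v" using far_small_tight[OF assms(1) assms(2)[OF assms(1)] _ v] nopath by auto
    then have "card (far v) < 2 * k" "v \<in> V" using assms(2) by (auto simp: tight_def)
    then have "card V \<le> degree V E v + 2 * k" using card_V[of v] degree_nbr[of v] by simp
    then have "card V \<le> 4 * k + degree ?A E v"
      using degree_split[OF u(1) v] degree_far_le[of u v] assms(2)[OF assms(1)] by simp
    moreover have "6 * k \<le> 6 * k ^ 2" by (simp add: power2_eq_square)
    ultimately show ?thesis using large by linarith
  qed
  then have "2 * k * card ?A \<le> (\<Sum>v\<in>?A. degree ?A E v)"
    using sum_bounded_below[of ?A "2 * k" "degree ?A E"] by (simp add: mult.commute)
  ultimately have "2 * k * card ?A \<le> (2 * k + 1 - 2) * card ?A" by linarith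
  then show False using u(2) k2 by simp
qed

lemma tight_imp_cycles:
  assumes "tight u"
  shows "has_cycle V E (2 * k + 1) \<and> has_cycle V E (2 * k + 2)"
proof (cases "\<exists>v. tight v \<and> card (far v) \<ge> 2 * k")
  case True
  then show ?thesis using far_large_even far_large_odd by blast
next
  case False
  then obtain xs where xs: "path_in (nbr u) E xs" "length xs = 2 * k + 1"
    using far_small[OF assms] by (meson not_le)
  have u: "u \<in> V" using assms by (simp add: tight_def)
  have "has_cycle V E (Suc (length xs))" by (rule cycle_through[OF u xs(1)]) (use xs in auto)
  \<comment> \<open>Cutting the path by one vertex yields the shorter of the two cycles.\<close>
  moreover have "has_cycle V E (Suc (length (take (2 * k) xs)))"
    by (rule cycle_through[OF u path_in_take[OF xs(1)]]) (use xs k2 in auto)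
  ultimately show ?thesis using xs(2) by simp
qed

end

section \<open>The largest eigenvalue\<close>

text \<open>Both directions are needed: one carries eigenvalues of the graph into the spectrum of a
  matrix, the other brings an eigenvector of the matrix back to \<open>V\<close>.\<close>

lemma mat_mult_vec_reindex:
  fixes Q :: "'a \<Rightarrow> 'a \<Rightarrow> complex"
  assumes f: "bij_betw f {0..<n} V"
  shows "(mat n n (\<lambda>(i, j). Q (f i) (f j)) *\<^sub>v vec n (\<lambda>i. z (f i)) = \<mu> \<cdot>\<^sub>v vec n (\<lambda>i. z (f i)))
    \<longleftrightarrow> (\<forall>u\<in>V. (\<Sum>v\<in>V. Q u v * z v) = \<mu> * z u)" (is "?L \<longleftrightarrow> ?R")
proof -
  have sum: "(\<Sum>v\<in>V. Q u v * z v) = (\<Sum>j = 0..<n. Q u (f j) * z (f j))" for u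
    using sum.reindex_bij_betw[OF f, of "\<lambda>v. Q u v * z v"] by simp
  have "?L \<longleftrightarrow> (\<forall>i<n. (\<Sum>j = 0..<n. Q (f i) (f j) * z (f j)) = \<mu> * z (f i))"
    by (auto simp: vec_eq_iff scalar_prod_def)
  also have "\<dots> \<longleftrightarrow> (\<forall>u\<in>f ` {0..<n}. (\<Sum>v\<in>V. Q u v * z v) = \<mu> * z u)"
    unfolding sum by auto
  also have "f ` {0..<n} = V" using f by (simp add: bij_betw_def)
  finally show ?thesis .
qed

text \<open>The Hermitian form \<open>S\<close> of \<open>z\<close> equals its own conjugate, and it
  is also \<open>\<mu>\<close> times the positive number \<open>N\<close>.\<close>

lemma symmetric_eigenvalue_real:
  fixes Q :: "'a \<Rightarrow> 'a \<Rightarrow> real" and z :: "'a \<Rightarrow> complex"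
  assumes "finite V" "\<And>u v. Q u v = Q v u" "v0 \<in> V" "z v0 \<noteq> 0"
    and ev: "\<And>u. u \<in> V \<Longrightarrow> (\<Sum>v\<in>V. of_real (Q u v) * z v) = \<mu> * z u"
  shows "\<mu> \<in> \<real>"
proof -
  define S where "S = (\<Sum>u\<in>V. cnj (z u) * (\<Sum>v\<in>V. of_real (Q u v) * z v))"
  define N where "N = (\<Sum>u\<in>V. (cmod (z u))\<^sup>2)"
  have "cnj S = (\<Sum>u\<in>V. \<Sum>v\<in>V. of_real (Q u v) * (z u * cnj (z v)))"
    by (simp add: S_def sum_distrib_left mult_ac)
  also have "\<dots> = (\<Sum>v\<in>V. \<Sum>u\<in>V. of_real (Q u v) * (z u * cnj (z v)))" by (rule sum.swap)
  also have "\<dots> = S"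
    unfolding S_def sum_distrib_left by (intro sum.cong refl) (simp add: assms(2) mult_ac)
  finally have "S \<in> \<real>" by (simp add: Reals_cnj_iff)
  have "S = (\<Sum>u\<in>V. \<mu> * (z u * cnj (z u)))"
    unfolding S_def by (intro sum.cong refl) (subst ev, auto)
  also have "\<dots> = \<mu> * of_real N"
    by (simp add: N_def sum_distrib_left complex_norm_square del: of_real_power)
  finally have "\<mu> * of_real N \<in> \<real>" using \<open>S \<in> \<real>\<close> by simp
  moreover have "N > 0"
    unfolding N_def using assms by (intro sum_pos2[of _ v0]) auto
  ultimately have "\<mu> * of_real N / of_real N \<in> \<real>" by (intro Reals_divide) auto
  then show ?thesis using \<open>N > 0\<close> by simp
qed

text \<open>The \<open>Max\<close> defining the index is attained once the set of eigenvalues is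
  finite and nonempty. Finiteness comes from the complex spectrum; a complex eigenvalue exists and
  is real by symmetry.\<close>

lemma sl_eigenvalue_q_index:
  assumes "finite V" "V \<noteq> {}" and sym: "\<And>u v. E u v \<Longrightarrow> E v u"
  shows "sl_eigenvalue V E (q_index V E)"
proof -
  define Q where "Q = signless_laplacian V E"
  have Q_sym: "Q u v = Q v u" for u v
    using sym by (auto simp: Q_def signless_laplacian_def)
  define n where "n = card V"
  obtain f where f: "bij_betw f {0..<n} V"
    using ex_bij_betw_nat_finite[OF assms(1)] by (auto simp: n_def)
  define M where "M = mat n n (\<lambda>(i, j). complex_of_real (Q (f i) (f j)))"
  have M: "M \<in> carrier_mat n n" by (simp add: M_def)
  note eq = mat_mult_vec_reindex[OF f, of "\<lambda>u v. complex_of_real (Q u v)", folded M_def]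
  have fV: "f i \<in> V" if "i < n" for i using f that by (auto simp: bij_betw_def)
  have "complex_of_real \<mu> \<in> spectrum M" if ev: "sl_eigenvalue V E \<mu>" for \<mu>
  proof -
    obtain x v where x: "v \<in> V" "x v \<noteq> 0" "\<forall>u\<in>V. (\<Sum>v\<in>V. Q u v * x v) = \<mu> * x u"
      using ev unfolding sl_eigenvalue_def Q_def by blast
    obtain i where i: "i < n" "v = f i" using x(1) f by (auto simp: bij_betw_def)
    let ?z = "\<lambda>v. complex_of_real (x v)"
    have "\<forall>u\<in>V. (\<Sum>v\<in>V. of_real (Q u v) * ?z v) = of_real \<mu> * ?z u"
      using x(3) by (metis (no_types, lifting) of_real_mult of_real_sum sum.cong)
    then have "M *\<^sub>v vec n (\<lambda>i. ?z (f i)) = of_real \<mu> \<cdot>\<^sub>v vec n (\<lambda>i. ?z (f i))"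
      using eq[of ?z] by simp
    moreover have "vec n (\<lambda>i. ?z (f i)) \<noteq> 0\<^sub>v n"
      using i x(2) by (metis index_vec index_zero_vec(1) of_real_eq_0_iff)
    ultimately have "eigenvector M (vec n (\<lambda>i. ?z (f i))) (of_real \<mu>)"
      using M by (simp add: eigenvector_def)
    then show ?thesis by (auto simp: spectrum_def eigenvalue_def)
  qed
  then have "of_real ` {\<mu>. sl_eigenvalue V E \<mu>} \<subseteq> spectrum M" by auto
  then have "finite (complex_of_real ` {\<mu>. sl_eigenvalue V E \<mu>})"
    using card_finite_spectrum(1)[OF M] finite_subset by blast
  then have fin: "finite {\<mu>. sl_eigenvalue V E \<mu>}" by (rule finite_imageD) (simp add: inj_on_def)
  have "n > 0" using assms by (simp add: n_def card_gt_0_iff)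
  then obtain \<mu> y where y: "y \<in> carrier_vec n" "y \<noteq> 0\<^sub>v n" "M *\<^sub>v y = \<mu> \<cdot>\<^sub>v y"
    using spectrum_non_empty[OF M] M by (auto simp: spectrum_def eigenvalue_def eigenvector_def)
  define z where "z v = y $ (the_inv_into {0..<n} f v)" for v
  have zf: "z (f i) = y $ i" if "i < n" for i
    using f that by (simp add: z_def the_inv_into_f_f bij_betw_def)
  have yz: "y = vec n (\<lambda>i. z (f i))" using y(1) zf by (intro eq_vecI) auto
  then have ev: "(\<Sum>v\<in>V. of_real (Q u v) * z v) = \<mu> * z u" if "u \<in> V" for u
    using eq[of z \<mu>] y(3) that by simp
  obtain i where i: "i < n" "y $ i \<noteq> 0"
    using y(1,2) by (metis carrier_vecD eq_vecI index_zero_vec)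
  have z0: "f i \<in> V" "z (f i) \<noteq> 0" using i zf fV by auto
  have "\<mu> \<in> \<real>" by (rule symmetric_eigenvalue_real[of V Q "f i" z]) (use assms Q_sym z0 ev in auto)
  then obtain m where m: "\<mu> = of_real m" by (auto elim: Reals_cases)
  \<comment> \<open>As \<open>m\<close> and the matrix are real, the real and imaginary parts of
    \<open>z\<close> satisfy the same equation; one of them is nonzero at
    \<open>f i\<close>.\<close>
  have "sl_eigenvalue V E m"
  proof (cases "Re (z (f i)) = 0")
    case True
    then have "Im (z (f i)) \<noteq> 0" using z0 by (simp add: complex_eq_iff)
    moreover have "\<forall>u\<in>V. (\<Sum>v\<in>V. Q u v * Im (z v)) = m * Im (z u)"
      using arg_cong[OF ev, of _ Im] m by simp
    ultimately show ?thesis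
      using z0(1) unfolding sl_eigenvalue_def Q_def by (intro exI[of _ "\<lambda>v. Im (z v)"]) auto
  next
    case False
    moreover have "\<forall>u\<in>V. (\<Sum>v\<in>V. Q u v * Re (z v)) = m * Re (z u)"
      using arg_cong[OF ev, of _ Re] m by simp
    ultimately show ?thesis
      using z0(1) unfolding sl_eigenvalue_def Q_def by (intro exI[of _ "\<lambda>v. Re (z v)"]) auto
  qed
  then have "{\<mu>. sl_eigenvalue V E \<mu>} \<noteq> {}" by blast
  then show ?thesis using Max_in[OF fin] by (simp add: q_index_def)
qed

lemma signless_laplacian_mult:
  fixes x :: "'a \<Rightarrow> real"
  assumes "finite V" "u \<in> V"
  shows "(\<Sum>v\<in>V. signless_laplacian V E u v * x v)
    = degree V E u * x u + (\<Sum>w | w \<in> V \<and> E u w. x w)"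
proof -
  have "(\<Sum>v\<in>V. signless_laplacian V E u v * x v)
      = (\<Sum>v\<in>V. if v = u then degree V E u * x v else 0) + (\<Sum>v\<in>V. if E u v then x v else 0)"
    unfolding sum.distrib[symmetric]
    by (intro sum.cong refl) (auto simp: signless_laplacian_def algebra_simps)
  then show ?thesis using assms by (simp add: sum.If_cases Int_def)
qed

theorem theorem1:
  fixes V :: "'a set" and E :: "'a \<Rightarrow> 'a \<Rightarrow> bool" and k n :: nat
  assumes "simple_graph V E"
    and "card V = n"
    and "k \<ge> 2"
    and "n > 6 * k ^ 2"
    and "q_index V E \<ge> real n + 2 * real k - 2"
  shows "has_cycle V E (2 * k + 1) \<and> has_cycle V E (2 * k + 2)"
proof -
  define q where "q = q_index V E"
  define d where "d v = real (degree V E v)" for v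
  have fin: "finite V" and edge: "\<And>u v. E u v \<Longrightarrow> u \<in> V \<and> v \<in> V \<and> u \<noteq> v \<and> E v u"
    using assms(1) by (auto simp: simple_graph_def)
  have "V \<noteq> {}" using assms(2,4) by auto
  have "sl_eigenvalue V E q"
    unfolding q_def by (rule sl_eigenvalue_q_index) (use fin \<open>V \<noteq> {}\<close> edge in auto)
  then obtain x v0 where v0: "v0 \<in> V" "x v0 \<noteq> 0"
    and x: "\<forall>u\<in>V. (\<Sum>v\<in>V. signless_laplacian V E u v * x v) = q * x u"
    unfolding sl_eigenvalue_def by blast
  define q0 where "q0 = real (card V + 2 * k - 2)"
  have q0: "q0 = real n + 2 * real k - 2" using assms(2,3) by (simp add: q0_def of_nat_diff)
  then have "q0 > 0" "q0 \<le> q" using assms(3,4,5) by (auto simp: q_def)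
  \<comment> \<open>Taking moduli in the eigenvalue equation costs only the triangle
    inequality.\<close>
  have sub: "q0 * \<bar>x v\<bar> \<le> d v * \<bar>x v\<bar> + (\<Sum>w | w \<in> V \<and> E v w. \<bar>x w\<bar>)" if "v \<in> V" for v
  proof -
    have "q0 * \<bar>x v\<bar> \<le> q * \<bar>x v\<bar>" using \<open>q0 \<le> q\<close> by (intro mult_right_mono) auto
    also have "\<dots> = \<bar>q * x v\<bar>" using \<open>q0 > 0\<close> \<open>q0 \<le> q\<close> by (simp add: abs_mult)
    also have "q * x v = d v * x v + (\<Sum>w | w \<in> V \<and> E v w. x w)"
      using x signless_laplacian_mult[OF fin that, of E x] that by (simp add: d_def)
    also have "\<bar>\<dots>\<bar> \<le> \<bar>d v * x v\<bar> + \<bar>\<Sum>w | w \<in> V \<and> E v w. x w\<bar>" by (rule abs_triangle_ineq)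
    also have "\<dots> \<le> d v * \<bar>x v\<bar> + (\<Sum>w | w \<in> V \<and> E v w. \<bar>x w\<bar>)"
      by (intro add_mono sum_abs) (simp add: abs_mult d_def)
    finally show ?thesis .
  qed
  have isolated: "x v = 0" if "v \<in> V" "d v = 0" for v
  proof -
    have "{w \<in> V. E v w} = {}" using that fin by (simp add: d_def degree_def)
    then have "(\<Sum>w | w \<in> V \<and> E v w. \<bar>x w\<bar>) = 0" by (simp only: sum.empty)
    then have "q0 * \<bar>x v\<bar> \<le> 0" using sub[OF that(1)] that(2) by simp
    then show ?thesis using \<open>q0 > 0\<close> by (simp add: mult_le_0_iff)
  qed
  \<comment> \<open>Dividing by the largest ratio gives \<open>r\<close> at most the degree, with
    equality at a maximiser \<open>u\<close>. At an isolated vertex the ratio is 0 by division by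
    zero, consistent with \<open>x\<close> vanishing there; hence \<open>M > 0\<close> also forces
    \<open>d u \<noteq> 0\<close>.\<close>
  define M where "M = Max ((\<lambda>v. \<bar>x v\<bar> / d v) ` V)"
  have M_ge: "\<bar>x v\<bar> / d v \<le> M" if "v \<in> V" for v
    unfolding M_def using that fin by (intro Max_ge) auto
  have "M \<in> (\<lambda>v. \<bar>x v\<bar> / d v) ` V"
    unfolding M_def using fin \<open>V \<noteq> {}\<close> by (intro Max_in) auto
  then obtain u where u: "u \<in> V" "M = \<bar>x u\<bar> / d u" by blast
  have d_pos: "d v > 0" if "d v \<noteq> 0" for v using that by (simp add: d_def)
  have "M > 0"
  proof -
    have "d v0 > 0" using isolated v0 d_pos by blast
    then have "\<bar>x v0\<bar> / d v0 > 0" using v0 by simp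
    then show ?thesis using M_ge[OF v0(1)] by linarith
  qed
  define r where "r v = \<bar>x v\<bar> / M" for v
  interpret degree_bounded_weight E V k r
  proof
    fix v assume v: "v \<in> V"
    show "r v \<le> degree V E v"
    proof (cases "d v = 0")
      case True
      then show ?thesis using isolated v by (simp add: r_def)
    next
      case False
      then show ?thesis
        using M_ge[OF v] d_pos[OF False] \<open>M > 0\<close> by (simp add: r_def d_def field_simps)
    qed
    have "q0 * \<bar>x v\<bar> / M \<le> (d v * \<bar>x v\<bar> + (\<Sum>w | w \<in> V \<and> E v w. \<bar>x w\<bar>)) / M"
      using sub[OF v] \<open>M > 0\<close> by (intro divide_right_mono) auto
    then show "real (card V + 2 * k - 2) * r v
        \<le> degree V E v * r v + (\<Sum>w | w \<in> V \<and> E v w. r w)"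
      by (simp add: r_def d_def q0_def add_divide_distrib sum_divide_distrib)
  qed (use edge fin assms \<open>M > 0\<close> in \<open>auto simp: r_def\<close>)
  have "d u \<noteq> 0" using u \<open>M > 0\<close> by auto
  then have "tight u"
    using u \<open>M > 0\<close> by (auto simp: tight_def r_def d_def field_simps)
  then show ?thesis by (rule tight_imp_cycles)
qed

end
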